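(* Let $A_2(n)$ denote the number of simply paired partitions of $n$ having pairing rank $-2$. For a nonnegative integer $m$, let $\chi(m)=1$ if $m=2^\alpha u^2$ for some $\alpha\ge0$ and some positive odd integer $u$, and $\chi(m)=0$ otherwise. Then for every $n\geq 0$, $$A_2(n+8)+A_2(n)\equiv n+1+\chi(n+3)+\chi(n+7)\pmod 2.$$ In particular, if $n$ is even, then $A_2(n+8)$ and $A_2(n)$ have the same parity if and only if one of $n+3$ and $n+7$ is a perfect square.
   Context: A partition is simply paired if no part occurs more than three times. For a partition $\lambda$, let $r(\lambda)$ be the largest part size of multiplicity at least $2$ ($r(\lambda)=0$ if $\lambda$ has distinct parts). Let $u_1>u_2>\cdots$ be the part sizes occurring with odd multiplicity, each taken once, and let $s(\lambda)=u_1-u_2+u_3-u_4+\cdots$ ($0$ if there are none). The pairing rank is $\rho(\lambda)=r(\lambda)-s(\lambda)$. *)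

theory Defs
  imports
    "HOL-Library.Multiset"
    "HOL-Number_Theory.Cong"
    "HOL-Computational_Algebra.Nth_Powers"
begin

definition is_partition :: "nat multiset \<Rightarrow> nat \<Rightarrow> bool" where
  "is_partition p n \<longleftrightarrow> 0 \<notin># p \<and> sum_mset p = n"

definition simply_paired :: "nat multiset \<Rightarrow> bool" where
  "simply_paired p \<longleftrightarrow> (\<forall>k\<in>#p. count p k \<le> 3)"

(* Inserting 0 realises the convention that the value is 0 when no part is repeated. *)
definition largest_repeated :: "nat multiset \<Rightarrow> nat" where
  "largest_repeated p = Max (insert 0 {k \<in> set_mset p. count p k \<ge> 2})"

definition odd_parts_desc :: "nat multiset \<Rightarrow> nat list" where
  "odd_parts_desc p = rev (sorted_list_of_set {k \<in> set_mset p. odd (count p k)})"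

(* x1 - x2 + x3 - x4 + ... *)
fun alt_sum :: "nat list \<Rightarrow> int" where
  "alt_sum [] = 0"
| "alt_sum (x # xs) = int x - alt_sum xs"

definition pairing_rank :: "nat multiset \<Rightarrow> int" where
  "pairing_rank p = int (largest_repeated p) - alt_sum (odd_parts_desc p)"

definition A2 :: "nat \<Rightarrow> nat" where
  "A2 n = card {p. is_partition p n \<and> simply_paired p \<and> pairing_rank p = - 2}"

definition chi :: "nat \<Rightarrow> nat" where
  "chi m = (if \<exists>\<alpha> u. odd u \<and> m = 2 ^ \<alpha> * u\<^sup>2 then 1 else 0)"

(* The cardinality in A2 is a genuine count, not the default value of card on infinite sets. *)
lemma finite_partitions: "finite {p. is_partition p n}"
proof (rule finite_subset)
  show "{p. is_partition p n} \<subseteq> mset ` {xs. set xs \<subseteq> {0..n} \<and> length xs \<le> n}"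
  proof
    fix p assume "p \<in> {p. is_partition p n}"
    then have p: "0 \<notin># p" "sum_mset p = n" by (auto simp: is_partition_def)
    obtain xs where xs: "mset xs = p" using ex_mset by blast
    have s: "sum_list xs = n" using p xs by (metis sum_mset_sum_list)
    have z: "0 \<notin> set xs" using p xs by auto
    have "0 \<notin> set ys \<Longrightarrow> length ys \<le> sum_list ys" for ys :: "nat list"
      by (induction ys) auto
    then have "length xs \<le> n" using s z by blast
    moreover have "set xs \<subseteq> {0..n}" using s member_le_sum_list by fastforce
    ultimately show "p \<in> mset ` {xs. set xs \<subseteq> {0..n} \<and> length xs \<le> n}"
      using xs by blast
  qed
  show "finite (mset ` {xs. set xs \<subseteq> {0..n} \<and> length xs \<le> n})"
    by (intro finite_imageI finite_lists_length_le) simp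
qed

end

theory Submission
  imports Defs "HOL-Library.Z2" "HOL-Computational_Algebra.Formal_Power_Series"
begin

text \<open>
  A simply paired partition is a pair \<open>(D, E)\<close> of sets of parts: those of odd multiplicity and
  those of multiplicity at least 2. Its size is \<open>\<Sum>D + 2 * \<Sum>E\<close>, and its rank is \<open>max E\<close> minus the
  alternating sum of \<open>D\<close>. Removing the largest part shows that the sets \<open>D \<subseteq> {1..m}\<close> with
  alternating sum \<open>k\<close> have generating function \<open>q^k\<close> times the \<open>q^2\<close>-binomial coefficient of \<open>m\<close> over
  \<open>k\<close>, which tends to \<open>q^k / (q^2; q^2)_k\<close>. The sets \<open>E\<close> with maximum \<open>r \<ge> 1\<close> contribute
  \<open>q^(2r) (-q^2; q^2)_(r-1)\<close>. Mod 2 the product for \<open>k = r + 2\<close> is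
  \<open>q^(3r+2) / ((1 - q^(2r)) (1 - q^(2r+2)) (1 - q^(2r+4)))\<close>. Its partial fractions telescope mod 2 when
  summed over \<open>r\<close> and leave the Lambert series with terms \<open>q^(3r) / (1 - q^(2r))\<close>, whose \<open>i\<close>-th
  coefficient is the number of odd divisors of \<open>i\<close> greater than 1. An odd number has an odd number
  of divisors exactly when it is a square.
\<close>

unbundle fps_syntax

subsection \<open>Alternating sums of sets of distinct parts\<close>

definition alt_sum_set :: "nat set \<Rightarrow> int" where
  "alt_sum_set D = alt_sum (rev (sorted_list_of_set D))"

lemma alt_sum_set_empty [simp]: "alt_sum_set {} = 0"
  by (simp add: alt_sum_set_def)

text \<open>Parts are listed in decreasing order, so a new largest part becomes the head of the list
  and all later signs flip.\<close>

lemma alt_sum_set_insert_greater: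
  assumes "finite D" "\<And>x. x \<in> D \<Longrightarrow> x < m"
  shows "alt_sum_set (insert m D) = int m - alt_sum_set D"
proof -
  have "sorted_list_of_set (insert m D) = sorted_list_of_set D @ [m]"
    using assms by (intro sorted_distinct_set_unique) (auto simp: sorted_append intro: less_imp_le simp del: sorted_list_of_set_insert_remove)
  then show ?thesis by (simp add: alt_sum_set_def)
qed

lemma finite_Pow_atLeastAtMost: "A \<in> Pow {1..m::nat} \<Longrightarrow> finite A"
  by (metis PowD finite_atLeastAtMost finite_subset)

lemma Pow_atLeastAtMost_Suc:
  "Pow {1..Suc m} = Pow {1..m} \<union> insert (Suc m) ` Pow {1..m}"
  by (simp add: atLeastAtMostSuc_conv Pow_insert)

lemma inj_on_insert_Suc: "inj_on (insert (Suc m)) (Pow {1..m})"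
proof (rule inj_onI)
  fix x y assume "x \<in> Pow {1..m}" "y \<in> Pow {1..m}" "insert (Suc m) x = insert (Suc m) y"
  moreover from this have "Suc m \<notin> x" "Suc m \<notin> y" by auto
  ultimately show "x = y" by (simp add: insert_ident)
qed

lemma sum_Pow_atLeastAtMost_Suc:
  fixes f :: "nat set \<Rightarrow> 'a::comm_monoid_add"
  shows "(\<Sum>D\<in>Pow {1..Suc m}. f D) = (\<Sum>D\<in>Pow {1..m}. f D) + (\<Sum>D\<in>Pow {1..m}. f (insert (Suc m) D))"
proof -
  have "(\<Sum>D\<in>Pow {1..Suc m}. f D) = (\<Sum>D\<in>Pow {1..m}. f D) + (\<Sum>D\<in>insert (Suc m) ` Pow {1..m}. f D)"
    unfolding Pow_atLeastAtMost_Suc by (rule sum.union_disjoint) auto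
  then show ?thesis by (simp only: sum.reindex[OF inj_on_insert_Suc] o_def)
qed

text \<open>Dropping a top element \<open>Suc m\<close> leaves an alternating sum in 0..m, and the
  reflection \<open>s\<close> to \<open>Suc m - s\<close> keeps it within 0..m+1. This confines the
  indices at which \<open>alt_sum_gf\<close> is nonzero.\<close>

lemma alt_sum_set_bounds:
  "D \<subseteq> {1..m} \<Longrightarrow> 0 \<le> alt_sum_set D \<and> alt_sum_set D \<le> int m"
proof (induction m arbitrary: D)
  case (Suc m)
  show ?case
  proof (cases "Suc m \<in> D")
    case True
    define D' where "D' = D - {Suc m}"
    have D': "D' \<subseteq> {1..m}" "D = insert (Suc m) D'"
      using Suc.prems True by (fastforce simp: D'_def le_Suc_eq)+
    then have "alt_sum_set D = int (Suc m) - alt_sum_set D'"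
      unfolding D'(2) by (intro alt_sum_set_insert_greater finite_subset[OF D'(1)]) auto
    then show ?thesis using Suc.IH[OF D'(1)] by auto
  next
    case False
    then have "D \<subseteq> {1..m}" using Suc.prems by (auto simp: le_Suc_eq)
    then show ?thesis using Suc.IH[of D] by simp
  qed
qed simp

text \<open>The index \<open>k\<close> is an integer because the recursion in \<open>m\<close>
  reflects it to \<open>int (Suc m) - k\<close>, which may be negative.\<close>

definition alt_sum_gf :: "nat \<Rightarrow> int \<Rightarrow> 'a::comm_ring_1 fps" where
  "alt_sum_gf m k = (\<Sum>D\<in>Pow {1..m}. if alt_sum_set D = k then fps_X ^ \<Sum>D else 0)"

text \<open>In the usual notation \<open>qfact n\<close> is \<open>(q^2; q^2)_n\<close>.\<close>

definition qfact :: "nat \<Rightarrow> 'a::comm_ring_1 fps" where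
  "qfact n = (\<Prod>i=1..n. 1 - fps_X ^ (2 * i))"

lemma qfact_0 [simp]: "qfact 0 = 1" and
  qfact_Suc: "qfact (Suc n) = qfact n * (1 - fps_X ^ (2 * Suc n))"
  by (simp_all add: qfact_def)

lemma alt_sum_gf_0: "alt_sum_gf 0 k = (if k = 0 then 1 else 0)"
  by (simp add: alt_sum_gf_def)

lemma alt_sum_gf_eq_0: "k < 0 \<or> int m < k \<Longrightarrow> alt_sum_gf m k = 0"
  unfolding alt_sum_gf_def by (rule sum.neutral) (auto dest!: alt_sum_set_bounds simp del: One_nat_def)

lemma alt_sum_gf_Suc:
  "alt_sum_gf (Suc m) k = alt_sum_gf m k + fps_X ^ Suc m * alt_sum_gf m (int (Suc m) - k)"
proof -
  have 1: "alt_sum_set (insert (Suc m) D) = int (Suc m) - alt_sum_set D"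
    "\<Sum>(insert (Suc m) D) = Suc m + \<Sum>D" if "D \<in> Pow {1..m}" for D
  proof -
    have "finite D" using that by (rule finite_Pow_atLeastAtMost)
    moreover have "Suc m \<notin> D" using that by auto
    ultimately show "\<Sum>(insert (Suc m) D) = Suc m + \<Sum>D" by simp
    show "alt_sum_set (insert (Suc m) D) = int (Suc m) - alt_sum_set D"
      using that \<open>finite D\<close> by (intro alt_sum_set_insert_greater) auto
  qed
  have "(\<Sum>D\<in>Pow {1..m}. if alt_sum_set (insert (Suc m) D) = k then fps_X ^ \<Sum>(insert (Suc m) D) else 0)
    = (fps_X ^ Suc m * alt_sum_gf m (int (Suc m) - k) :: 'a fps)"
    unfolding alt_sum_gf_def sum_distrib_left
    by (intro sum.cong refl) (auto simp: 1 power_add)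
  then show ?thesis
    unfolding alt_sum_gf_def sum_Pow_atLeastAtMost_Suc by simp
qed

text \<open>This is \<open>q^k\<close> times the \<open>q^2\<close>-binomial coefficient, with
  denominators cleared. By the symmetry of binomial coefficients the reflected index
  \<open>Suc m - k\<close> stands for \<open>k - 1\<close>, so \<open>alt_sum_gf_Suc\<close> becomes
  the Pascal rule for base \<open>q^2\<close>.\<close>

lemma alt_sum_gf_q_binomial:
  "k \<le> m \<Longrightarrow> alt_sum_gf m (int k) * qfact k * qfact (m - k) = fps_X ^ k * (qfact m :: 'a::comm_ring_1 fps)"
proof (induction m arbitrary: k)
  case 0
  then show ?case by (simp add: alt_sum_gf_0)
next
  case (Suc m)
  note rec = alt_sum_gf_Suc[of m "int k"]
  \<comment> \<open>At the two ends of the range one of the two terms of the recursion vanishes;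
    only the third case needs both.\<close>
  consider "k = 0" | "k = Suc m" | j l where "k = Suc j" "m = j + l + 1"
  proof (cases k)
    case (Suc j)
    then show ?thesis using \<open>k \<le> Suc m\<close> that(2) that(3)[of j "m - k"] by (cases "k = Suc m") auto
  qed (use that in blast)
  then show ?case
  proof cases
    case 1
    then have "alt_sum_gf (Suc m) 0 = (alt_sum_gf m 0 :: 'a fps)"
      by (simp add: rec alt_sum_gf_Suc alt_sum_gf_eq_0)
    then show ?thesis using Suc.IH[of 0] 1 by (simp add: qfact_Suc flip: mult.assoc)
  next
    case 2
    then have "alt_sum_gf (Suc m) (int k) = (fps_X ^ Suc m * alt_sum_gf m 0 :: 'a fps)"
      by (simp add: alt_sum_gf_Suc[of m "int (Suc m)"] alt_sum_gf_eq_0 del: of_nat_Suc)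
    then show ?thesis using Suc.IH[of 0] 2 by (simp add: qfact_Suc mult.assoc) (simp flip: mult.assoc)
  next
    case 3
    have e: "m - k = l" "Suc m - k = Suc l" "m - Suc l = j" "Suc l \<le> m" "k \<le> m"
       "int (Suc m) - int k = int (Suc l)" using 3 by auto
    define A B :: "'a fps" where "A = alt_sum_gf m (int k)" and "B = alt_sum_gf m (int (Suc l))"
    have r: "alt_sum_gf (Suc m) (int k) = A + fps_X ^ Suc m * B"
      unfolding rec e(6) A_def B_def ..
    have q: "qfact k = (qfact j * (1 - fps_X ^ (2 * k)) :: 'a fps)"
      unfolding 3(1) by (rule qfact_Suc)
    have A: "A * qfact k * qfact l = fps_X ^ k * qfact m"
      using Suc.IH[OF e(5)] unfolding A_def e(1) .
    have B: "B * qfact (Suc l) * qfact j = fps_X ^ Suc l * qfact m"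
      using Suc.IH[OF e(4)] unfolding B_def e(3) .
    \<comment> \<open>Since \<open>k + Suc l = Suc m\<close>, all powers involved are products of
      \<open>u\<close> and \<open>v\<close>, and the Pascal rule reduces to
      \<open>(1 - v^2) + v^2 * (1 - u^2) = 1 - u^2 * v^2\<close>.\<close>
    define u v :: "'a fps" where "u = fps_X ^ k" and "v = fps_X ^ Suc l"
    have uv: "fps_X ^ (2 * k) = u * u" "fps_X ^ (2 * Suc l) = v * v" "fps_X ^ Suc m = u * v"
      unfolding u_def v_def power_add[symmetric] using 3 by (simp_all add: mult_2)
    note q = q[unfolded uv]
    have qSl: "qfact (Suc l) = qfact l * (1 - v * v)"
      unfolding uv(2)[symmetric] by (rule qfact_Suc)
    have "alt_sum_gf (Suc m) (int k) * qfact k * qfact (Suc m - k)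
      = (A + u * v * B) * qfact k * qfact (Suc l)"
      by (simp only: r e(2) uv)
    also have "\<dots> = (A * qfact k * qfact l) * (1 - v * v) + u * v * (B * qfact (Suc l) * qfact j) * (1 - u * u)"
      unfolding qSl q by (simp add: algebra_simps)
    also have "\<dots> = u * qfact m * (1 - v * v) + u * v * (v * qfact m) * (1 - u * u)"
      unfolding A B u_def v_def ..
    also have "\<dots> = u * (qfact m * (1 - (u * v) * (u * v)))"
      by (simp add: algebra_simps)
    also have "(u * v) * (u * v) = fps_X ^ (2 * Suc m)"
      unfolding uv(3)[symmetric] power_add[symmetric] mult_2 ..
    finally show ?thesis unfolding u_def qfact_Suc .
  qed
qed

section \<open>Congruence of power series up to a given degree, and the limit of the
  \<open>q^2\<close>-binomial coefficients\<close>

lemma fps_X_power_dvd_iff: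
  "fps_X ^ n dvd (f :: 'a::comm_ring_1 fps) \<longleftrightarrow> (\<forall>i<n. f $ i = 0)"
proof
  assume "\<forall>i<n. f $ i = 0"
  then have "f = fps_X ^ n * Abs_fps (\<lambda>i. f $ (i + n))"
    by (intro fps_ext) (simp add: fps_X_power_mult_nth)
  then show "fps_X ^ n dvd f" by (rule dvdI)
qed (auto simp: fps_X_power_mult_nth elim!: dvdE)

text \<open>Each factor beyond the first \<open>n\<close> differs from 1 by a multiple of
  \<open>q^(2n+2)\<close>.\<close>

lemma qfact_diff_dvd: "fps_X ^ (2 * n + 2) dvd qfact (n + k) - (qfact n :: 'a::comm_ring_1 fps)"
proof (induction k)
  case (Suc k)
  have "qfact (n + Suc k) - qfact n =
     (qfact (n + k) - qfact n) - fps_X ^ (2 * n + 2) * (fps_X ^ (2 * k) * qfact (n + k) :: 'a fps)"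
  proof -
    have "fps_X ^ (2 * Suc (n + k)) = (fps_X ^ (2 * n + 2) * fps_X ^ (2 * k) :: 'a fps)"
      by (simp add: power_add)
    then show ?thesis by (simp add: qfact_Suc right_diff_distrib mult_ac)
  qed
  then show ?case using Suc by (metis dvd_diff dvd_triv_left)
qed simp

lemma qfact_nth_0 [simp]: "qfact n $ 0 = 1"
  by (induction n) (simp_all add: qfact_Suc)

text \<open>A quantitative form of the limit \<open>q^k / (q^2; q^2)_k\<close>: the series for
  \<open>{1..m}\<close> agrees with it through degree \<open>m\<close>, whatever \<open>k\<close>
  is.\<close>

lemma alt_sum_gf_dvd:
  "fps_X ^ (m + 1) dvd alt_sum_gf m (int k) * qfact k - (fps_X ^ k :: 'a::field fps)"
proof (cases "k \<le> m")
  case False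
  then have "fps_X ^ (m + 1) dvd (fps_X ^ k :: 'a fps)" by (intro le_imp_power_dvd) simp
  with False show ?thesis by (simp add: alt_sum_gf_eq_0)
next
  case True
  \<comment> \<open>The exponent on the right is
    \<open>k + 2 * (m - k) + 2 = (m + 1) + (m - k + 1)\<close>.\<close>
  have "fps_X ^ (m + 1) dvd fps_X ^ k * (fps_X ^ (2 * (m - k) + 2) :: 'a fps)"
    using True by (subst power_add[symmetric], intro le_imp_power_dvd) simp
  also have "\<dots> dvd fps_X ^ k * (qfact m - qfact (m - k))"
    using qfact_diff_dvd[of "m - k" k, where ?'a = 'a] True
    by (intro mult_dvd_mono dvd_refl) (simp only: le_add_diff_inverse2)
  also have "\<dots> = (alt_sum_gf m (int k) * qfact k - fps_X ^ k) * qfact (m - k)"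
    by (simp only: right_diff_distrib left_diff_distrib alt_sum_gf_q_binomial[OF True])
  finally have 1: "fps_X ^ (m + 1) dvd (alt_sum_gf m (int k) * qfact k - fps_X ^ k) * (qfact (m - k) :: 'a fps)" .
  \<comment> \<open>A series with constant term 1 is a unit, so it can be cancelled from a
    divisibility.\<close>
  have "qfact (m - k) dvd (1 :: 'a fps)"
    by (simp only: fps_is_unit_iff qfact_nth_0 one_neq_zero not_False_eq_True)
  then show ?thesis by (rule iffD1[OF dvd_mult_unit_iff 1])
qed

subsection \<open>Simply paired partitions as pairs of sets\<close>

definition max_gf :: "nat \<Rightarrow> 'a::comm_ring_1 fps" where
  "max_gf r = (\<Sum>E\<in>Pow {1..r}. if Max (insert 0 E) = r then fps_X ^ (2 * \<Sum>E) else 0)"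

lemma sum_subsets_eq_prod:
  "(\<Sum>E\<in>Pow {1..r}. fps_X ^ (2 * \<Sum>E)) = (\<Prod>j=1..r. 1 + fps_X ^ (2 * j) :: 'a::comm_ring_1 fps)"
proof (induction r)
  case (Suc r)
  have "\<Sum>(insert (Suc r) E) = Suc r + \<Sum>E" if "E \<in> Pow {1..r}" for E
  proof -
    have "finite E" using that by (rule finite_Pow_atLeastAtMost)
    moreover have "Suc r \<notin> E" using that by auto
    ultimately show ?thesis by simp
  qed
  then have "(\<Sum>E\<in>Pow {1..r}. fps_X ^ (2 * \<Sum>(insert (Suc r) E)))
     = fps_X ^ (2 * Suc r) * (\<Sum>E\<in>Pow {1..r}. fps_X ^ (2 * \<Sum>E) :: 'a fps)"
    unfolding sum_distrib_left[where ?'a = "'a fps"] by (intro sum.cong refl) (simp add: power_add distrib_left)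
  then have "(\<Sum>E\<in>Pow {1..Suc r}. fps_X ^ (2 * \<Sum>E)) = (\<Prod>j=1..r. 1 + fps_X ^ (2 * j))
     + fps_X ^ (2 * Suc r) * (\<Prod>j=1..r. 1 + fps_X ^ (2 * j) :: 'a fps)"
    by (simp only: sum_Pow_atLeastAtMost_Suc Suc)
  then show ?case by (simp add: algebra_simps)
qed simp

lemma max_gf_0: "max_gf 0 = 1"
  by (simp add: max_gf_def)

lemma Max_insert_0_le:
  assumes "E \<subseteq> {1..r::nat}"
  shows "Max (insert 0 E) \<le> r"
proof -
  have "finite E" using assms finite_subset by blast
  then show ?thesis using assms by auto
qed

text \<open>A set with maximum \<open>Suc r\<close> is \<open>Suc r\<close> together with an
  arbitrary subset of \<open>{1..r}\<close>.\<close>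

lemma max_gf_Suc:
  "max_gf (Suc r) = fps_X ^ (2 * Suc r) * (\<Prod>j=1..r. 1 + fps_X ^ (2 * j) :: 'a::comm_ring_1 fps)"
proof -
  have 1: "Max (insert 0 E) \<noteq> Suc r" "\<Sum>(insert (Suc r) E) = Suc r + \<Sum>E"
    "Max (insert 0 (insert (Suc r) E)) = Suc r" if "E \<in> Pow {1..r}" for E
  proof -
    have E: "finite E" using that by (rule finite_Pow_atLeastAtMost)
    have "Suc r \<notin> E" using that by auto
    then show "\<Sum>(insert (Suc r) E) = Suc r + \<Sum>E" using E by simp
    show "Max (insert 0 E) \<noteq> Suc r" using Max_insert_0_le[of E r] that by simp
    show "Max (insert 0 (insert (Suc r) E)) = Suc r"
      using that E by (intro Max_eqI) auto
  qed
  have "max_gf (Suc r) = (\<Sum>E\<in>Pow {1..r}. fps_X ^ (2 * \<Sum>(insert (Suc r) E)) :: 'a fps)"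
    unfolding max_gf_def sum_Pow_atLeastAtMost_Suc by (simp add: 1)
  also have "\<dots> = (\<Sum>E\<in>Pow {1..r}. fps_X ^ (2 * Suc r) * fps_X ^ (2 * \<Sum>E))"
    by (intro sum.cong refl) (simp add: 1 power_add distrib_left)
  finally show ?thesis by (simp only: sum_distrib_left[symmetric] sum_subsets_eq_prod)
qed

text \<open>A set of maximum \<open>r\<close> lies in \<open>{1..r}\<close> anyway. Using the larger
  ambient set gives all \<open>r\<close> the same range of summation.\<close>

lemma max_gf_bounded:
  assumes "r \<le> m"
  shows "(\<Sum>E\<in>Pow {1..m}. if Max (insert 0 E) = r then fps_X ^ (2 * \<Sum>E) else 0) = (max_gf r :: 'a::comm_ring_1 fps)"
  unfolding max_gf_def
proof (rule sum.mono_neutral_cong_right)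
  show "\<forall>E\<in>Pow {1..m} - Pow {1..r}. (if Max (insert 0 E) = r then fps_X ^ (2 * \<Sum>E) else 0) = (0 :: 'a fps)"
  proof
    fix E assume E: "E \<in> Pow {1..m} - Pow {1..r}"
    have "finite E" using E finite_Pow_atLeastAtMost by blast
    obtain x where x: "x \<in> E" "x \<notin> {1..r}" "x \<in> {1..m}" using E by blast
    then have "x \<le> Max (insert 0 E)" using \<open>finite E\<close> by (intro Max_ge) auto
    then have "Max (insert 0 E) \<noteq> r" using x by auto
    then show "(if Max (insert 0 E) = r then fps_X ^ (2 * \<Sum>E) else 0) = (0 :: 'a fps)" by simp
  qed
  show "Pow {1..r} \<subseteq> Pow {1..m}" using assms by (intro Pow_mono) simp
qed simp_all

section \<open>The bijection with pairs of sets, and the generating function of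
  \<open>A2\<close>\<close>

definition paired_mset :: "nat set \<times> nat set \<Rightarrow> nat multiset" where
  "paired_mset = (\<lambda>(D, E). mset_set D + mset_set E + mset_set E)"

definition odd_count_set :: "nat multiset \<Rightarrow> nat set" where
  "odd_count_set p = {k \<in> set_mset p. odd (count p k)}"

definition repeated_set :: "nat multiset \<Rightarrow> nat set" where
  "repeated_set p = {k \<in> set_mset p. count p k \<ge> 2}"

lemma in_odd_count_set_iff: "x \<in> odd_count_set p \<longleftrightarrow> odd (count p x)"
  by (cases "count p x = 0") (auto simp: odd_count_set_def count_inI)

lemma in_repeated_set_iff: "x \<in> repeated_set p \<longleftrightarrow> count p x \<ge> 2"
  by (cases "count p x = 0") (auto simp: repeated_set_def count_inI)

lemma count_mset_set_of_bool: "finite A \<Longrightarrow> count (mset_set A) x = of_bool (x \<in> A)"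
  by (simp add: count_mset_set')

lemma count_paired_mset:
  assumes "finite D" "finite E"
  shows "count (paired_mset (D, E)) x = of_bool (x \<in> D) + 2 * of_bool (x \<in> E)"
  using assms by (simp add: paired_mset_def count_mset_set_of_bool)

text \<open>A multiplicity from 0 to 3 is read in binary: the first set records the digit of weight
  1, the second the digit of weight 2.\<close>

lemma paired_mset_inverse:
  assumes "simply_paired p"
  shows "paired_mset (odd_count_set p, repeated_set p) = p"
proof (rule multiset_eqI)
  fix x
  have fin: "finite (odd_count_set p)" "finite (repeated_set p)"
    by (auto simp: odd_count_set_def repeated_set_def)
  have "count p x \<le> 3"
    using assms by (cases "count p x = 0") (auto simp: simply_paired_def count_inI)
  then consider "count p x = 0" | "count p x = 1" | "count p x = 2" | "count p x = 3" by linarith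
  then have "of_bool (odd (count p x)) + 2 * of_bool (2 \<le> count p x) = count p x"
    by cases simp_all
  then show "count (paired_mset (odd_count_set p, repeated_set p)) x = count p x"
    by (simp only: count_paired_mset[OF fin] in_odd_count_set_iff in_repeated_set_iff)
qed

lemma
  assumes "finite D" "finite E"
  shows odd_count_set_paired_mset: "odd_count_set (paired_mset (D, E)) = D"
    and repeated_set_paired_mset: "repeated_set (paired_mset (D, E)) = E"
    and simply_paired_paired_mset: "simply_paired (paired_mset (D, E))"
    and sum_paired_mset: "sum_mset (paired_mset (D, E)) = \<Sum>D + 2 * \<Sum>E"
proof -
  show "odd_count_set (paired_mset (D, E)) = D"
    by (rule set_eqI) (simp add: in_odd_count_set_iff count_paired_mset[OF assms])
  show "repeated_set (paired_mset (D, E)) = E"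
    by (rule set_eqI) (simp add: in_repeated_set_iff count_paired_mset[OF assms])
  show "simply_paired (paired_mset (D, E))"
    by (simp add: simply_paired_def count_paired_mset[OF assms])
  show "sum_mset (paired_mset (D, E)) = \<Sum>D + 2 * \<Sum>E"
    by (simp add: paired_mset_def sum_unfold_sum_mset)
qed

lemma pairing_rank_eq:
  "pairing_rank p = int (Max (insert 0 (repeated_set p))) - alt_sum_set (odd_count_set p)"
  by (simp add: pairing_rank_def largest_repeated_def odd_parts_desc_def repeated_set_def
      odd_count_set_def alt_sum_set_def)

text \<open>Parts of a partition of \<open>n\<close> are at most \<open>n\<close>, so any bound
  \<open>m\<close> with \<open>n \<le> m\<close> serves; later one \<open>m\<close> is shared by
  \<open>A2 n\<close> and \<open>A2 (n + 8)\<close>.\<close>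

lemma A2_eq_card_pairs:
  assumes "n \<le> m"
  shows "A2 n = card {(D, E). D \<in> Pow {1..m} \<and> E \<in> Pow {1..m} \<and>
    alt_sum_set D = int (Max (insert 0 E)) + 2 \<and> \<Sum>D + 2 * \<Sum>E = n}" (is "_ = card ?S")
proof -
  let ?T = "{p. is_partition p n \<and> simply_paired p \<and> pairing_rank p = - 2}"
  have "bij_betw paired_mset ?S ?T"
  proof (rule bij_betw_byWitness[where f' = "\<lambda>p. (odd_count_set p, repeated_set p)"])
    have fin: "finite D" "finite E" if "(D, E) \<in> ?S" for D E
      using that finite_Pow_atLeastAtMost[of D m] finite_Pow_atLeastAtMost[of E m] by simp_all
    show "\<forall>x\<in>?S. (odd_count_set (paired_mset x), repeated_set (paired_mset x)) = x"
    proof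
      fix x assume x: "x \<in> ?S"
      obtain D E where DE: "x = (D, E)" by (cases x)
      note f = fin[OF x[unfolded DE]]
      show "(odd_count_set (paired_mset x), repeated_set (paired_mset x)) = x"
        unfolding DE odd_count_set_paired_mset[OF f] repeated_set_paired_mset[OF f] ..
    qed
    show "\<forall>p\<in>?T. paired_mset (odd_count_set p, repeated_set p) = p"
      by (simp add: paired_mset_inverse)
    show "paired_mset ` ?S \<subseteq> ?T"
    proof
      fix p assume "p \<in> paired_mset ` ?S"
      then obtain x where x: "p = paired_mset x" "x \<in> ?S" by (rule imageE)
      obtain D E where xDE: "x = (D, E)" by (cases x)
      note DE = x(2,1)[unfolded xDE]
      note f = fin[OF DE(1)]
      have "0 \<notin># p" using DE f by (auto simp: paired_mset_def)
      then show "p \<in> ?T"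
        using DE by (simp add: is_partition_def pairing_rank_eq odd_count_set_paired_mset[OF f]
            repeated_set_paired_mset[OF f] simply_paired_paired_mset[OF f] sum_paired_mset[OF f])
    qed
    show "(\<lambda>p. (odd_count_set p, repeated_set p)) ` ?T \<subseteq> ?S"
    proof
      fix x assume "x \<in> (\<lambda>p. (odd_count_set p, repeated_set p)) ` ?T"
      then obtain p where p: "p \<in> ?T" "x = (odd_count_set p, repeated_set p)" by blast
      have "set_mset p \<subseteq> {1..m}"
      proof
        fix k assume k: "k \<in># p"
        then have "k \<le> n" using p(1) by (auto simp: is_partition_def dest!: multi_member_split)
        moreover have "k \<noteq> 0" using k p(1) by (intro notI) (simp add: is_partition_def)
        ultimately show "k \<in> {1..m}" using assms by simp
      qed
      then have s: "odd_count_set p \<subseteq> {1..m}" "repeated_set p \<subseteq> {1..m}"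
        by (auto simp: odd_count_set_def repeated_set_def)
      have fin: "finite (odd_count_set p)" "finite (repeated_set p)"
        by (auto simp: odd_count_set_def repeated_set_def)
      have "n = sum_mset (paired_mset (odd_count_set p, repeated_set p))"
        using p by (simp add: paired_mset_inverse is_partition_def)
      then show "x \<in> ?S" using p s by (simp add: sum_paired_mset[OF fin] pairing_rank_eq)
    qed
  qed
  then show ?thesis unfolding A2_def by (simp add: bij_betw_same_card)
qed

text \<open>Pairs are grouped by the maximum \<open>r\<close> of \<open>E\<close>; rank -2 then
  forces \<open>D\<close> to have alternating sum \<open>r + 2\<close>.\<close>

lemma A2_gf_nth:
  assumes "n \<le> m"
  shows "(\<Sum>r\<le>m. max_gf r * alt_sum_gf m (int r + 2)) $ n = (of_nat (A2 n) :: 'a::comm_ring_1)"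
proof -
  let ?P = "Pow {1..m}"
  have "(\<Sum>r\<le>m. max_gf r * alt_sum_gf m (int r + 2) :: 'a fps)
    = (\<Sum>r\<le>m. \<Sum>E\<in>?P. if Max (insert 0 E) = r then fps_X ^ (2 * \<Sum>E) * alt_sum_gf m (int r + 2) else 0)"
    by (intro sum.cong refl) (auto simp: max_gf_bounded[symmetric] sum_distrib_right intro!: sum.cong)
  also have "\<dots> = (\<Sum>E\<in>?P. \<Sum>r\<le>m. if Max (insert 0 E) = r then fps_X ^ (2 * \<Sum>E) * alt_sum_gf m (int r + 2) else 0)"
    by (rule sum.swap)
  \<comment> \<open>The maximum of \<open>E\<close> is at most \<open>m\<close>, so exactly one
    \<open>r\<close> contributes.\<close>
  also have "\<dots> = (\<Sum>E\<in>?P. fps_X ^ (2 * \<Sum>E) * alt_sum_gf m (int (Max (insert 0 E)) + 2))"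
    using Max_insert_0_le[of _ m] by (intro sum.cong refl) (simp add: sum.delta)
  also have "\<dots> = (\<Sum>E\<in>?P. \<Sum>D\<in>?P. if alt_sum_set D = int (Max (insert 0 E)) + 2 then fps_X ^ (\<Sum>D + 2 * \<Sum>E) else 0)"
    unfolding alt_sum_gf_def sum_distrib_left[where ?'a = "'a fps"]
    by (intro sum.cong refl) (auto simp: power_add)
  also have "\<dots> = (\<Sum>D\<in>?P. \<Sum>E\<in>?P. if alt_sum_set D = int (Max (insert 0 E)) + 2 then fps_X ^ (\<Sum>D + 2 * \<Sum>E) else 0)"
    by (rule sum.swap)
  also have "\<dots> $ n = (\<Sum>(D, E)\<in>?P \<times> ?P.
     of_bool (alt_sum_set D = int (Max (insert 0 E)) + 2 \<and> \<Sum>D + 2 * \<Sum>E = n))"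
    unfolding sum.cartesian_product fps_sum_nth
    by (intro sum.cong refl) auto
  also have "\<dots> = of_nat (card {(D, E). D \<in> Pow {1..m} \<and> E \<in> Pow {1..m} \<and>
    alt_sum_set D = int (Max (insert 0 E)) + 2 \<and> \<Sum>D + 2 * \<Sum>E = n})"
    by (subst case_prod_unfold, subst sum_of_bool_eq)
      (auto intro!: arg_cong[where f = "\<lambda>A. of_nat (card A)"])
  finally show ?thesis using A2_eq_card_pairs[OF assms] by simp
qed


subsection \<open>Reduction mod 2\<close>

lemma bit_fps_numeral [simp]:
  "numeral (Num.Bit0 k) = (0 :: bit fps)" "numeral (Num.Bit1 k) = (1 :: bit fps)"
  by (simp_all add: numeral_fps_const)

lemma bit_fps_add_self [simp]: "f + f = (0 :: bit fps)"
  by (simp flip: mult_2)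

lemma bit_fps_add_self_left [simp]: "f + (f + g) = (g :: bit fps)"
  by (simp flip: add.assoc)

lemma bit_fps_diff: "f - g = f + (g :: bit fps)"
  by (rule fps_ext) simp

lemma of_nat_bit: "of_nat n = (of_bool (odd n) :: bit)"
  by (induction n) auto

lemma of_nat_bit_eq_iff: "of_nat a = (of_nat b :: bit) \<longleftrightarrow> [a = b] (mod 2)"
  by (auto simp: of_nat_bit cong_def mod_2_eq_odd)

text \<open>The series \<open>q^(3r) / (1 - q^(2r))\<close>, given by its coefficients.\<close>

definition odd_codivisor_gf :: "nat \<Rightarrow> bit fps" where
  "odd_codivisor_gf r = Abs_fps (\<lambda>m. of_bool (r dvd m \<and> odd (m div r) \<and> m \<noteq> r))"

text \<open>At \<open>r * c\<close> the coefficient is 1 exactly for odd \<open>c \<ge> 3\<close>.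
  Adding the shift by \<open>2 * r\<close> cancels every pair \<open>c\<close>, \<open>c - 2\<close>
  mod 2 except at \<open>c = 3\<close>.\<close>

lemma odd_codivisor_gf_mult:
  assumes "r > 0"
  shows "odd_codivisor_gf r * (1 + fps_X ^ (2 * r)) = fps_X ^ (3 * r)"
proof (rule fps_ext)
  fix n
  have *: "(odd_codivisor_gf r * (1 + fps_X ^ (2 * r))) $ n
     = odd_codivisor_gf r $ n + (if n < 2 * r then 0 else odd_codivisor_gf r $ (n - 2 * r))"
    by (simp only: distrib_left mult_1_right fps_add_nth fps_X_power_mult_right_nth)
  show "(odd_codivisor_gf r * (1 + fps_X ^ (2 * r))) $ n = fps_X ^ (3 * r) $ n"
  proof (cases "r dvd n")
    case False
    then have "n \<noteq> 3 * r" "\<not> (2 * r \<le> n \<and> r dvd n - 2 * r)"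
      by (auto simp: dvd_minus_self dest: dvd_diffD)
    then show ?thesis unfolding * using False by (auto simp: odd_codivisor_gf_def)
  next
    case True
    then obtain c where c: "n = r * c" by (rule dvdE)
    have H: "odd_codivisor_gf r $ (r * d) = of_bool (odd d \<and> d \<noteq> 1)" for d
      using assms by (auto simp: odd_codivisor_gf_def)
    have e: "n < 2 * r \<longleftrightarrow> c < 2" "n = 3 * r \<longleftrightarrow> c = 3" "n - 2 * r = r * (c - 2)"
      using assms by (auto simp: c diff_mult_distrib2)
    have "of_bool (odd c \<and> c \<noteq> 1) + (if c < 2 then 0 else of_bool (odd (c - 2) \<and> c - 2 \<noteq> 1)) = (of_bool (c = 3) :: bit)"
    proof (cases "c < 4")
      case True
      then consider "c = 0" | "c = 1" | "c = 2" | "c = 3" by linarith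
      then show ?thesis by cases simp_all
    next
      case False
      then have "c - 2 \<noteq> 1" "c \<noteq> 3" "\<not> c < 2" "c \<noteq> 1" by simp_all
      then show ?thesis by (simp del: add_bit_eq_xor)
    qed
    then show ?thesis unfolding * e unfolding c H using e(2) by (simp add: c)
  qed
qed

text \<open>To be read with \<open>x = q\<close> and \<open>y = q^r\<close>: \<open>g\<close> is the
  series for maximum \<open>r\<close>, and \<open>h\<close>, \<open>h'\<close>, \<open>h''\<close>
  are \<open>q^(3i) / (1 - q^(2i))\<close> for \<open>i = r, r+1, r+2\<close>. After multiplication
  by the three denominators, nonzero because \<open>y\<close> has no constant term, a polynomial
  identity over the field of two elements remains.\<close>

lemma partial_fraction:
  fixes x y g h h' h'' :: "bit fps"
  assumes g: "g * ((1 + y * y) * (1 + y * y * x ^ 2) * (1 + y * y * x ^ 4)) = y * y * y * x ^ 2"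
    and h: "h * (1 + y * y) = y * y * y"
    and h': "h' * (1 + y * y * x ^ 2) = y * y * y * x ^ 3"
    and h'': "h'' * (1 + y * y * x ^ 4) = y * y * y * x ^ 6"
    and y: "y $ 0 = 0"
  shows "(1 + x ^ 8) * g = x * (1 + x ^ 2) * (x * h + (1 + x ^ 2) * h' + x * h'')"
proof -
  define a b c where "a = 1 + y * y" and "b = 1 + y * y * x ^ 2" and "c = 1 + y * y * x ^ 4"
  have "a $ 0 = 1" "b $ 0 = 1" "c $ 0 = 1" using y by (simp_all add: a_def b_def c_def)
  then have nz: "a * b * c \<noteq> 0" by auto
  have "((1 + x ^ 8) * g) * (a * b * c) = (1 + x ^ 8) * (y * y * y * x ^ 2)"
    using g by (simp add: a_def b_def c_def mult.assoc)
  also have "\<dots> = x * (1 + x ^ 2) * (x * (y * y * y) * (b * c) + (1 + x ^ 2) * (y * y * y * x ^ 3) * (a * c)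
     + x * (y * y * y * x ^ 6) * (a * b))"
    unfolding a_def b_def c_def by (simp add: algebra_simps eval_nat_numeral)
  also have "\<dots> = x * (1 + x ^ 2) * (x * (h * a) * (b * c) + (1 + x ^ 2) * (h' * b) * (a * c)
     + x * (h'' * c) * (a * b))"
    by (simp only: h h' h'' a_def b_def c_def)
  also have "\<dots> = x * (1 + x ^ 2) * (x * h + (1 + x ^ 2) * h' + x * h'') * (a * b * c)"
    by (simp only: algebra_simps)
  finally show ?thesis by (rule mult_right_cancel[OF nz, THEN iffD1])
qed

text \<open>Pairing \<open>d\<close> with \<open>v div d\<close> leaves only a square root of the odd part \<open>v\<close> of \<open>i\<close> unmatched.\<close>

lemma card_odd_divisors_parity:
  assumes "i > 0"
  shows "odd (card {d. d dvd i \<and> odd d}) \<longleftrightarrow> chi i = 1"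
proof -
  obtain a v where v: "i = 2 ^ a * v" "odd v"
    using assms by (metis Suc_leI numeral_2_eq_2 lessI multiplicity_decompose' not_is_unit_0 nat_dvd_1_iff_1 One_nat_def n_not_Suc_n neq0_conv)
  have v0: "v > 0" using v by (auto intro: Nat.gr0I)
  have "{d. d dvd i \<and> odd d} = {d. d dvd v}"
  proof (intro Collect_cong iffI conjI)
    fix d assume "d dvd i \<and> odd d"
    then show "d dvd v"
      using v coprime_dvd_mult_right_iff[of d "2 ^ a" v] by (simp add: coprime_commute)
  next
    fix d assume "d dvd v"
    then show "d dvd i" "odd d" using v dvd_trans by (auto intro: dvd_mult)
  qed
  define L E G where "L = {d. d dvd v \<and> d * d < v}" and "E = {d. d dvd v \<and> d * d = v}"
    and "G = {d. d dvd v \<and> d * d > v}"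
  have fin: "finite {d. d dvd v}" using v0 by simp
  have finLEG: "finite L" "finite E" "finite G"
    by (rule finite_subset[OF _ fin]; auto simp: L_def E_def G_def)+
  have "bij_betw (\<lambda>d. v div d) L G"
  proof (rule bij_betw_byWitness[where f' = "\<lambda>d. v div d"])
    have inv: "v div (v div d) = d" if "d dvd v" for d
      using that v0 by (auto elim!: dvdE)
    show "\<forall>d\<in>L. v div (v div d) = d" "\<forall>d\<in>G. v div (v div d) = d"
      using inv by (auto simp: L_def G_def)
    show "(\<lambda>d. v div d) ` L \<subseteq> G" "(\<lambda>d. v div d) ` G \<subseteq> L"
      using v0 by (auto simp: L_def G_def elim!: dvdE)
  qed
  then have LG: "card L = card G" by (rule bij_betw_same_card)
  have "{d. d dvd v} = L \<union> E \<union> G" by (auto simp: L_def E_def G_def)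
  moreover have disj: "L \<inter> E = {}" "(L \<union> E) \<inter> G = {}" by (auto simp: L_def E_def G_def)
  ultimately have "card {d. d dvd v} = card L + card E + card G"
    using finLEG disj by (simp add: card_Un_disjoint)
  then have "odd (card {d. d dvd v}) \<longleftrightarrow> odd (card E)" using LG by (simp; blast)
  moreover have "odd (card E) \<longleftrightarrow> (\<exists>d. v = d\<^sup>2)"
  proof (cases "\<exists>d. v = d\<^sup>2")
    case True
    then obtain d where d: "v = d\<^sup>2" by blast
    then have "E = {d}" by (auto simp: E_def simp flip: power2_eq_square)
    then show ?thesis using True by simp
  next
    case False
    then have "E = {}" by (auto simp: E_def power2_eq_square)
    then show ?thesis using False by simp
  qed
  moreover have "chi i = 1 \<longleftrightarrow> (\<exists>d. v = d\<^sup>2)"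
  proof
    assume "chi i = 1"
    then obtain b u where u: "odd u" "i = 2 ^ b * u\<^sup>2" unfolding chi_def by (auto split: if_splits)
    \<comment> \<open>Both \<open>v\<close> and \<open>u^2\<close> are the odd part of
      \<open>i\<close>; being odd, each is coprime to the power of 2 and hence divides the
      other.\<close>
    have "v dvd u\<^sup>2"
      using v u coprime_dvd_mult_right_iff[of v "2 ^ b" "u\<^sup>2"] by (metis coprime_power_right_iff coprime_right_2_iff_odd dvd_triv_right)
    moreover have "u\<^sup>2 dvd v"
      using v u coprime_dvd_mult_right_iff[of "u\<^sup>2" "2 ^ a" v] by (metis coprime_power_right_iff coprime_power_left_iff coprime_right_2_iff_odd dvd_triv_right)
    ultimately show "\<exists>d. v = d\<^sup>2" using dvd_antisym by blast
  next
    assume "\<exists>d. v = d\<^sup>2"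
    then obtain d where "v = d\<^sup>2" ..
    then have "odd d \<and> i = 2 ^ a * d\<^sup>2" using v by simp
    then show "chi i = 1" unfolding chi_def by auto
  qed
  ultimately show ?thesis using \<open>{d. d dvd i \<and> odd d} = {d. d dvd v}\<close> by simp
qed


text \<open>Of the multiples \<open>0, r, 2r\<close> below \<open>3r\<close>, two have an even
  quotient and \<open>r\<close> itself is excluded. This disposes of the boundary terms at
  \<open>m + 1\<close> and \<open>m + 2\<close>.\<close>

lemma odd_codivisor_gf_nth_small: "i < 3 * r \<Longrightarrow> odd_codivisor_gf r $ i = 0"
proof -
  assume i: "i < 3 * r"
  have False if dvd: "r dvd i" and ne: "odd (i div r)" "i \<noteq> r"
  proof -
    obtain c where c: "i = r * c" using dvd by (rule dvdE)
    then have "c < 3" "r > 0" using i by auto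
    then have "c = 0 \<or> c = 1 \<or> c = 2" by linarith
    then show False using ne c by auto
  qed
  then show ?thesis unfolding odd_codivisor_gf_def by auto
qed

text \<open>The map \<open>r\<close> to \<open>i div r\<close> turns the condition on
  \<open>r\<close> into \<open>i div r\<close> being an odd divisor of \<open>i\<close>. The
  excluded \<open>r = i\<close>, that is the divisor 1, accounts for the \<open>+ 1\<close>.\<close>

lemma sum_odd_codivisor_gf_nth:
  assumes "0 < i" "i \<le> m"
  shows "(\<Sum>r=1..m. odd_codivisor_gf r) $ i = of_nat (chi i + 1)"
proof -
  let ?R = "{r. r dvd i \<and> odd (i div r)}"
  have "finite ?R" using assms(1) by (intro finite_subset[OF _ finite_divisors_nat[of i]]) auto
  have "bij_betw (\<lambda>r. i div r) ?R {d. d dvd i \<and> odd d}"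
    using assms(1) by (intro bij_betw_byWitness[where f' = "\<lambda>r. i div r"]) (auto elim!: dvdE)
  then have card: "card ?R = card {d. d dvd i \<and> odd d}" by (rule bij_betw_same_card)
  have iR: "i \<in> ?R" using assms(1) by simp
  have "(\<Sum>r=1..m. odd_codivisor_gf r) $ i = (\<Sum>r\<in>{1..m}. of_bool (r dvd i \<and> odd (i div r) \<and> i \<noteq> r))"
    by (simp add: fps_sum_nth odd_codivisor_gf_def)
  also have "\<dots> = of_nat (card ({1..m} \<inter> {r. r dvd i \<and> odd (i div r) \<and> i \<noteq> r}))"
    by (rule sum_of_bool_eq) simp_all
  also have "{1..m} \<inter> {r. r dvd i \<and> odd (i div r) \<and> i \<noteq> r} = ?R - {i}"
  proof -
    have "r \<in> {1..m}" if "r dvd i" for r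
      using that assms dvd_imp_le[OF that] by (auto intro: Nat.gr0I)
    then show ?thesis by blast
  qed
  also have "of_nat (card (?R - {i})) = (of_nat (chi i + 1) :: bit)"
  proof -
    have "card ?R = Suc (card (?R - {i}))" by (rule card.remove[OF \<open>finite ?R\<close> iR])
    then have "even (card (?R - {i})) \<longleftrightarrow> chi i = 1"
      using card_odd_divisors_parity[OF assms(1)] card by simp
    moreover have "chi i = 0 \<or> chi i = 1" by (simp add: chi_def)
    ultimately have "[card (?R - {i}) = chi i + 1] (mod 2)"
      by (auto simp: cong_def mod_2_eq_odd)
    then show ?thesis by (simp only: of_nat_bit_eq_iff)
  qed
  finally show ?thesis .
qed

text \<open>The limit of \<open>max_gf r * alt_sum_gf m (int r + 2)\<close> as \<open>m\<close>
  grows, reduced mod 2.\<close>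

definition rank_gf :: "nat \<Rightarrow> bit fps" where
  "rank_gf r = max_gf r * fps_X ^ (r + 2) * inverse (qfact (r + 2))"

lemma rank_gf_mult_qfact: "rank_gf r * qfact (r + 2) = max_gf r * fps_X ^ (r + 2)"
proof -
  have "inverse (qfact (r + 2)) * qfact (r + 2) = (1 :: bit fps)"
    by (rule inverse_mult_eq_1) simp
  then show ?thesis unfolding rank_gf_def by (simp only: mult.assoc mult_1_right)
qed

text \<open>Up to degree \<open>m\<close>, restricting \<open>D\<close> to \<open>{1..m}\<close> does not matter.\<close>

lemma alt_sum_gf_rank_gf_dvd: "fps_X ^ (m + 1) dvd max_gf r * alt_sum_gf m (int r + 2) - rank_gf r"
proof -
  have e: "int r + 2 = int (r + 2)" by simp
  have "fps_X ^ (m + 1) dvd max_gf r * (alt_sum_gf m (int (r + 2)) * qfact (r + 2) - (fps_X ^ (r + 2) :: bit fps))"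
    by (intro dvd_mult alt_sum_gf_dvd)
  also have "\<dots> = (max_gf r * alt_sum_gf m (int r + 2) - rank_gf r) * qfact (r + 2)"
    unfolding e left_diff_distrib rank_gf_mult_qfact right_diff_distrib by (simp only: mult.assoc)
  finally have 1: "fps_X ^ (m + 1) dvd \<dots>" .
  have "qfact (r + 2) dvd (1 :: bit fps)"
    by (simp only: fps_is_unit_iff qfact_nth_0 one_neq_zero not_False_eq_True)
  then show ?thesis by (rule iffD1[OF dvd_mult_unit_iff 1])
qed

section \<open>Partial fractions of \<open>rank_gf\<close> and their sum over the maximum\<close>

lemma bit_qfact_Suc: "qfact (Suc n) = (qfact n * (1 + fps_X ^ (2 * Suc n)) :: bit fps)"
  by (simp only: qfact_Suc bit_fps_diff)

lemma qfact_eq_prod: "qfact n = (\<Prod>i=1..n. 1 + fps_X ^ (2 * i) :: bit fps)"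
  by (simp only: qfact_def bit_fps_diff)

text \<open>Mod 2 the product of the \<open>1 + q^(2j)\<close> in \<open>max_gf (Suc s)\<close>
  equals \<open>qfact s\<close>, so it cancels all but the last three factors of
  \<open>qfact (Suc s + 2)\<close>.\<close>

lemma rank_gf_Suc:
  "rank_gf (Suc s) * ((1 + fps_X ^ (2 * Suc s)) * (1 + fps_X ^ (2 * Suc s + 2)) * (1 + fps_X ^ (2 * Suc s + 4)))
   = fps_X ^ (3 * Suc s + 2)"
proof -
  have "qfact s $ 0 = (1 :: bit)" by simp
  then have nz: "qfact s \<noteq> (0 :: bit fps)" by (metis fps_zero_nth zero_neq_one)
  have i: "2 * Suc (Suc s) = 2 * Suc s + 2" "2 * Suc (Suc (Suc s)) = 2 * Suc s + 4" "Suc s + 2 = Suc (Suc (Suc s))"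
    by simp_all
  have q: "qfact (Suc s + 2) = (((1 + fps_X ^ (2 * Suc s)) * (1 + fps_X ^ (2 * Suc s + 2)) * (1 + fps_X ^ (2 * Suc s + 4))) * qfact s :: bit fps)"
    unfolding i(3) bit_qfact_Suc i(1,2) by (simp only: mult_ac)
  have m: "max_gf (Suc s) * fps_X ^ (Suc s + 2) = (fps_X ^ (3 * Suc s + 2) * qfact s :: bit fps)"
  proof -
    have "3 * Suc s + 2 = 2 * Suc s + (Suc s + 2)" by simp
    then show ?thesis unfolding max_gf_Suc qfact_eq_prod by (simp only: power_add mult_ac)
  qed
  show ?thesis
    using rank_gf_mult_qfact[of "Suc s"] unfolding q m mult.assoc[symmetric]
    by (rule mult_right_cancel[OF nz, THEN iffD1])
qed

lemma rank_gf_partial_fraction: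
  "(1 + fps_X ^ 8) * rank_gf (Suc s) = fps_X * (1 + fps_X ^ 2) *
     (fps_X * odd_codivisor_gf (Suc s) + (1 + fps_X ^ 2) * odd_codivisor_gf (Suc (Suc s))
       + fps_X * odd_codivisor_gf (Suc (Suc (Suc s))))"
proof (rule partial_fraction[where y = "fps_X ^ Suc s"])
  have p: "fps_X ^ Suc s * fps_X ^ Suc s = (fps_X ^ (2 * Suc s) :: bit fps)"
    "fps_X ^ Suc s * fps_X ^ Suc s * fps_X ^ Suc s = (fps_X ^ (3 * Suc s) :: bit fps)"
    unfolding power_add[symmetric] by (rule arg_cong[where f = "(^) fps_X"]; simp)+
  have i: "2 * Suc (Suc s) = 2 * Suc s + 2" "2 * Suc (Suc (Suc s)) = 2 * Suc s + 4"
     "3 * Suc (Suc s) = 3 * Suc s + 3" "3 * Suc (Suc (Suc s)) = 3 * Suc s + 6"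
    by simp_all
  show "rank_gf (Suc s) * ((1 + fps_X ^ Suc s * fps_X ^ Suc s) * (1 + fps_X ^ Suc s * fps_X ^ Suc s * fps_X\<^sup>2) *
      (1 + fps_X ^ Suc s * fps_X ^ Suc s * fps_X ^ 4)) = fps_X ^ Suc s * fps_X ^ Suc s * fps_X ^ Suc s * fps_X\<^sup>2"
    \<comment> \<open>Cubes are rewritten before squares, because the square is a subterm of the
      cube.\<close>
    unfolding p(2) unfolding p(1) unfolding power_add[symmetric] by (rule rank_gf_Suc)
  show "odd_codivisor_gf (Suc s) * (1 + fps_X ^ Suc s * fps_X ^ Suc s) = fps_X ^ Suc s * fps_X ^ Suc s * fps_X ^ Suc s"
    unfolding p(2) unfolding p(1) by (rule odd_codivisor_gf_mult) simp
  show "odd_codivisor_gf (Suc (Suc s)) * (1 + fps_X ^ Suc s * fps_X ^ Suc s * fps_X\<^sup>2)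
      = fps_X ^ Suc s * fps_X ^ Suc s * fps_X ^ Suc s * fps_X ^ 3"
    unfolding p(2) unfolding p(1) unfolding power_add[symmetric] i[symmetric] by (rule odd_codivisor_gf_mult) simp
  show "odd_codivisor_gf (Suc (Suc (Suc s))) * (1 + fps_X ^ Suc s * fps_X ^ Suc s * fps_X ^ 4)
      = fps_X ^ Suc s * fps_X ^ Suc s * fps_X ^ Suc s * fps_X ^ 6"
    unfolding p(2) unfolding p(1) unfolding power_add[symmetric] i[symmetric] by (rule odd_codivisor_gf_mult) simp
  show "(fps_X ^ Suc s) $ 0 = (0 :: bit)" by simp
qed

text \<open>Maximum 0 means \<open>E\<close> is empty, which the product formula for
  \<open>max_gf\<close> does not cover. Here \<open>1 + q^8 = (1 + q^2)^2 * (1 + q^4)\<close> mod 2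
  clears the denominator \<open>(1 + q^2) * (1 + q^4)\<close>.\<close>

lemma rank_gf_0: "(1 + fps_X ^ 8) * rank_gf 0 = fps_X ^ 2 + fps_X ^ 4"
proof -
  define x where "x = (fps_X :: bit fps)"
  have q: "qfact (0 + 2) = ((1 + x ^ 2) * (1 + x ^ 4) :: bit fps)"
    by (simp add: qfact_eq_prod x_def numeral_2_eq_2 eval_nat_numeral)
  have "((1 + x ^ 2) * (1 + x ^ 4)) $ 0 = (1 :: bit)" by (simp add: x_def)
  then have nz: "(1 + x ^ 2) * (1 + x ^ 4) \<noteq> 0" by (metis fps_zero_nth zero_neq_one)
  have "rank_gf 0 * ((1 + x ^ 2) * (1 + x ^ 4)) = x ^ 2"
    using rank_gf_mult_qfact[of 0] unfolding q by (simp add: max_gf_0 x_def power2_eq_square)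
  then have "(1 + x ^ 8) * rank_gf 0 * ((1 + x ^ 2) * (1 + x ^ 4)) = (1 + x ^ 8) * x ^ 2"
    by (simp only: mult.assoc)
  also have "\<dots> = (x ^ 2 + x ^ 4) * ((1 + x ^ 2) * (1 + x ^ 4))"
    by (simp add: algebra_simps eval_nat_numeral)
  finally show ?thesis unfolding x_def[symmetric] by (rule mult_right_cancel[OF nz, THEN iffD1])
qed

text \<open>After summation the two outer terms of each partial fraction decomposition cancel mod 2
  up to boundary terms.\<close>

lemma sum_rank_gf:
  "(1 + fps_X ^ 8) * (\<Sum>r=1..m. rank_gf r) = fps_X * (1 + fps_X ^ 2) *
     ((1 + fps_X ^ 2) * ((\<Sum>r=1..m. odd_codivisor_gf r) + odd_codivisor_gf 1 + odd_codivisor_gf (m + 1))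
       + fps_X * (odd_codivisor_gf 1 + odd_codivisor_gf 2 + odd_codivisor_gf (m + 1) + odd_codivisor_gf (m + 2)))"
proof (induction m)
  case 0
  then show ?case by (simp add: numeral_2_eq_2)
next
  case (Suc m)
  define S a b c d e where "S = (\<Sum>r=1..m. odd_codivisor_gf r)"
    and "a = odd_codivisor_gf 1" and "b = odd_codivisor_gf 2" and "c = odd_codivisor_gf (Suc m)"
    and "d = odd_codivisor_gf (Suc (Suc m))" and "e = odd_codivisor_gf (Suc (Suc (Suc m)))"
  have s: "(\<Sum>r=1..Suc m. odd_codivisor_gf r) = S + c" by (simp add: S_def c_def)
  have i: "m + 1 = Suc m" "m + 2 = Suc (Suc m)" "Suc m + 1 = Suc (Suc m)" "Suc m + 2 = Suc (Suc (Suc m))" by simp_all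
  have "(1 + fps_X ^ 8) * (\<Sum>r=1..Suc m. rank_gf r)
      = (1 + fps_X ^ 8) * (\<Sum>r=1..m. rank_gf r) + (1 + fps_X ^ 8) * rank_gf (Suc m)"
    by (simp add: distrib_left)
  also have "\<dots> = fps_X * (1 + fps_X ^ 2) * ((1 + fps_X ^ 2) * (S + a + c) + fps_X * (a + b + c + d))
      + fps_X * (1 + fps_X ^ 2) * (fps_X * c + (1 + fps_X ^ 2) * d + fps_X * e)"
    unfolding Suc rank_gf_partial_fraction i S_def a_def b_def c_def d_def e_def ..
  \<comment> \<open>The two copies of \<open>fps_X * c\<close> cancel, and \<open>d\<close>,
    \<open>e\<close> become the new boundary terms.\<close>
  also have "\<dots> = fps_X * (1 + fps_X ^ 2) * ((1 + fps_X ^ 2) * (S + c + a + d) + fps_X * (a + b + d + e))"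
    by (simp add: algebra_simps)
  finally show ?case unfolding s i a_def b_def d_def e_def .
qed

text \<open>Through degree \<open>m\<close> the boundary series at \<open>m + 1\<close> and
  \<open>m + 2\<close> vanish. The one at 1 collapses to monomials, so only the one at 2 and the
  full sum \<open>S\<close> survive.\<close>

lemma gf_parity:
  fixes m :: nat
  defines "G \<equiv> \<Sum>r\<le>m. max_gf r * alt_sum_gf m (int r + 2)"
    and "S \<equiv> \<Sum>r=1..m. odd_codivisor_gf r"
  shows "fps_X ^ (m + 1) dvd (1 + fps_X ^ 8) * G - (fps_X ^ 2 + fps_X ^ 5 + fps_X ^ 6
     + fps_X ^ 2 * (odd_codivisor_gf 2 + fps_X ^ 2 * odd_codivisor_gf 2) + fps_X * (S + fps_X ^ 4 * S))"
proof -
  define x where "x = (fps_X :: bit fps)"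
  define a b c d where "a = odd_codivisor_gf 1" and "b = odd_codivisor_gf 2"
    and "c = odd_codivisor_gf (m + 1)" and "d = odd_codivisor_gf (m + 2)"
  have "G - (\<Sum>r\<le>m. rank_gf r) = (\<Sum>r\<le>m. max_gf r * alt_sum_gf m (int r + 2) - rank_gf r)"
    unfolding G_def by (simp only: sum_subtractf)
  also have "x ^ (m + 1) dvd \<dots>" unfolding x_def by (intro dvd_sum alt_sum_gf_rank_gf_dvd)
  finally have 1: "x ^ (m + 1) dvd G - (\<Sum>r\<le>m. rank_gf r)" .
  have cd: "x ^ (m + 1) dvd c" "x ^ (m + 1) dvd d"
    unfolding x_def fps_X_power_dvd_iff c_def d_def by (auto intro: odd_codivisor_gf_nth_small)
  have s: "(\<Sum>r\<le>m. rank_gf r) = rank_gf 0 + (\<Sum>r=1..m. rank_gf r)"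
    by (simp add: atMost_atLeast0 sum.atLeast_Suc_atMost)
  \<comment> \<open>Every occurrence of \<open>a\<close> carries a factor \<open>1 + x^2\<close>, so
    \<open>a\<close> contributes \<open>x^4 + x^6 + x^5\<close>, and the \<open>x^4\<close> cancels
    against \<open>rank_gf 0\<close>.\<close>
  have a: "(1 + x ^ 2) * a = x ^ 3"
    unfolding a_def x_def using odd_codivisor_gf_mult[of 1] by (simp only: mult.commute mult_1 zero_less_one)
  have "(1 + x ^ 8) * (\<Sum>r\<le>m. rank_gf r)
    = x ^ 2 + x ^ 4 + x * (1 + x ^ 2) * ((1 + x ^ 2) * (S + a + c) + x * (a + b + c + d))"
    unfolding s x_def distrib_left[of "1 + fps_X ^ 8"] rank_gf_0 sum_rank_gf S_def a_def b_def c_def d_def ..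
  also have "\<dots> = x ^ 2 + x ^ 4 + x * (1 + x ^ 2) * ((1 + x ^ 2) * a) + x * x * ((1 + x ^ 2) * a)
      + x ^ 2 * (b + x ^ 2 * b) + x * (S + x ^ 4 * S) + (x * (1 + x ^ 2) * (1 + x ^ 2 + x) * c + x * (1 + x ^ 2) * x * d)"
    by (simp add: algebra_simps eval_nat_numeral)
  also have "\<dots> = (x ^ 2 + x ^ 5 + x ^ 6 + x ^ 2 * (b + x ^ 2 * b) + x * (S + x ^ 4 * S))
      + (x * (1 + x ^ 2) * (1 + x ^ 2 + x) * c + x * (1 + x ^ 2) * x * d)" (is "_ = ?R + ?E")
    unfolding a by (simp add: algebra_simps eval_nat_numeral)
  finally have 2: "(1 + x ^ 8) * (\<Sum>r\<le>m. rank_gf r) = ?R + ?E" .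
  have "(1 + x ^ 8) * G - ?R = (1 + x ^ 8) * (G - (\<Sum>r\<le>m. rank_gf r)) + ?E"
    by (simp only: right_diff_distrib 2) simp
  moreover have "x ^ (m + 1) dvd (1 + x ^ 8) * (G - (\<Sum>r\<le>m. rank_gf r)) + ?E"
    by (intro dvd_add dvd_mult 1 cd)
  ultimately have "x ^ (m + 1) dvd (1 + x ^ 8) * G - ?R" by (simp only:)
  then show ?thesis unfolding x_def b_def .
qed

lemma A2_parity: "[A2 (n + 8) + A2 n = n + 1 + chi (n + 3) + chi (n + 7)] (mod 2)"
proof -
  \<comment> \<open>The coefficient at \<open>n + 8\<close> is compared; the factor
    \<open>1 + q^8\<close> brings in \<open>A2 n\<close> beside \<open>A2 (n + 8)\<close>.\<close>
  define m where "m = n + 8"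
  define G where "G = (\<Sum>r\<le>m. max_gf r * alt_sum_gf m (int r + 2) :: bit fps)"
  define S where "S = (\<Sum>r=1..m. odd_codivisor_gf r)"
  define b where "b = odd_codivisor_gf 2"
  let ?R = "fps_X ^ 2 + fps_X ^ 5 + fps_X ^ 6 + fps_X ^ 2 * (b + fps_X ^ 2 * b) + fps_X * (S + fps_X ^ 4 * S)"
  have "((1 + fps_X ^ 8) * G - ?R) $ m = 0"
    using gf_parity[of m, folded G_def S_def b_def] unfolding fps_X_power_dvd_iff by simp
  then have "((1 + fps_X ^ 8) * G) $ m = ?R $ m" by (simp only: fps_sub_nth right_minus_eq)
  moreover have "((1 + fps_X ^ 8) * G) $ m = of_nat (A2 (n + 8) + A2 n)"
    unfolding distrib_right mult_1 fps_add_nth fps_X_power_mult_nth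
    using A2_gf_nth[of m m, where 'a = bit] A2_gf_nth[of n m, where 'a = bit]
    by (simp add: m_def G_def del: add_bit_eq_xor)
  \<comment> \<open>The polynomial part has degree 6, below \<open>m\<close>, and contributes
    nothing.\<close>
  moreover have "?R $ m = b $ (n + 6) + b $ (n + 4) + (S $ (n + 7) + S $ (n + 3))"
    unfolding fps_add_nth fps_X_mult_nth fps_X_power_mult_nth fps_X_power_nth m_def
    by (simp add: add.commute del: add_bit_eq_xor)
  \<comment> \<open>For even \<open>n\<close> the halves of \<open>n + 6\<close> and
    \<open>n + 4\<close> are consecutive, so exactly one is odd; for odd \<open>n\<close> neither
    index is divisible by 2.\<close>
  moreover have "b $ (n + 6) + b $ (n + 4) = of_nat (n + 1)"
  proof (cases "even n")
    case True
    then obtain k where "n = 2 * k" by (rule evenE)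
    then have "(n + 6) div 2 = k + 3" "(n + 4) div 2 = k + 2" by simp_all
    then show ?thesis using True by (cases "even k") (simp_all add: b_def odd_codivisor_gf_def of_nat_bit)
  next
    case False
    then show ?thesis by (simp add: b_def odd_codivisor_gf_def of_nat_bit)
  qed
  moreover have "S $ (n + 7) = of_nat (chi (n + 7) + 1)" "S $ (n + 3) = of_nat (chi (n + 3) + 1)"
    unfolding S_def by (rule sum_odd_codivisor_gf_nth; simp add: m_def)+
  ultimately have "of_nat (A2 (n + 8) + A2 n) = (of_nat (n + 1 + (chi (n + 7) + 1 + (chi (n + 3) + 1))) :: bit)"
    by (simp only: of_nat_add)
  then have "[A2 (n + 8) + A2 n = n + 1 + (chi (n + 7) + 1 + (chi (n + 3) + 1))] (mod 2)"
    by (simp only: of_nat_bit_eq_iff)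
  also have "[n + 1 + (chi (n + 7) + 1 + (chi (n + 3) + 1)) = n + 1 + chi (n + 3) + chi (n + 7)] (mod 2)"
    by (simp add: cong_def) presburger
  finally show ?thesis .
qed

section \<open>Perfect squares among \<open>n + 3\<close> and \<open>n + 7\<close>\<close>

lemma chi_odd:
  assumes "odd m"
  shows "chi m = of_bool (is_square m)"
proof -
  have "(\<exists>\<alpha> u. odd u \<and> m = 2 ^ \<alpha> * u\<^sup>2) \<longleftrightarrow> is_square m"
  proof
    assume "\<exists>\<alpha> u. odd u \<and> m = 2 ^ \<alpha> * u\<^sup>2"
    then obtain k u where "m = 2 ^ k * u\<^sup>2" by blast
    moreover from this have "k = 0" using assms by (cases k) auto
    ultimately show "is_square m" by (simp add: is_nth_power_def)
  next
    assume "is_square m"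
    then obtain u where "m = u\<^sup>2" by (auto elim: is_nth_powerE)
    moreover from this have "odd u" using assms by simp
    ultimately have "odd u \<and> m = 2 ^ 0 * u\<^sup>2" by simp
    then show "\<exists>\<alpha> u. odd u \<and> m = 2 ^ \<alpha> * u\<^sup>2" by blast
  qed
  then show ?thesis by (simp add: chi_def)
qed

text \<open>From \<open>a^2 = n + 3\<close> follows \<open>a \<ge> 2\<close>, so the next square is
  at least 5 larger, while the gap is 4. This turns the exclusive alternative given by parity into a
  plain disjunction.\<close>

lemma not_both_squares: "\<not> (is_square (n + 3) \<and> is_square (n + 7 :: nat))"
proof
  assume "is_square (n + 3) \<and> is_square (n + 7)"
  then obtain a b where ab: "n + 3 = a\<^sup>2" "n + 7 = b\<^sup>2" by (auto elim!: is_nth_powerE)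
  then have "a\<^sup>2 < b\<^sup>2" by linarith
  then have "a + 1 \<le> b" using power_less_imp_less_base by fastforce
  moreover have "a \<ge> 2"
  proof (rule ccontr)
    assume "\<not> a \<ge> 2"
    then have "a = 0 \<or> a = 1" by linarith
    then show False using ab(1) by auto
  qed
  ultimately have "(a + 1)\<^sup>2 \<le> b\<^sup>2" "2 * a + 1 \<ge> 5" by (simp_all add: power_mono)
  moreover have "(a + 1)\<^sup>2 = a\<^sup>2 + 2 * a + 1" by (simp add: power2_eq_square)
  ultimately show False using ab by linarith
qed

theorem theorem7p3:
  fixes n :: nat
  shows "[A2 (n + 8) + A2 n = n + 1 + chi (n + 3) + chi (n + 7)] (mod 2)
    \<and> (even n \<longrightarrow>
        ((even (A2 (n + 8)) \<longleftrightarrow> even (A2 n)) \<longleftrightarrow>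
          is_square (n + 3) \<or> is_square (n + 7)))"
proof (intro conjI impI)
  show "[A2 (n + 8) + A2 n = n + 1 + chi (n + 3) + chi (n + 7)] (mod 2)"
    by (rule A2_parity)
  assume "even n"
  then have "chi (n + 3) = of_bool (is_square (n + 3))" "chi (n + 7) = of_bool (is_square (n + 7))"
    by (intro chi_odd; simp)+
  moreover have "even (A2 (n + 8) + A2 n) \<longleftrightarrow> even (n + 1 + chi (n + 3) + chi (n + 7))"
    using A2_parity[of n] by (simp only: cong_def even_iff_mod_2_eq_zero)
  \<comment> \<open>As \<open>n + 1\<close> is odd, the parities agree exactly when one, and not
    both, of the two \<open>chi\<close> values is 1.\<close>
  ultimately show "(even (A2 (n + 8)) \<longleftrightarrow> even (A2 n)) \<longleftrightarrow> is_square (n + 3) \<or> is_square (n + 7)"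
    using \<open>even n\<close> not_both_squares[of n] by (cases "is_square (n + 3)"; cases "is_square (n + 7)") simp_all
qed

end
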